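(* Let $P \subset \mathbb{R}^2$ be a finite set of points, not all of which are collinear. Then $$|\nu(P)| = 2\,|P| - |\mathrm{Bd}(P)| - I_c(P) - 2 .$$
   Context: For a finite set $P\subset\mathbb{R}^2$ (the generating set) and $p\in P$, the Voronoi polygon of $p$ is $V(p)=\{x\in\mathbb{R}^2 : \|p-x\|\le\|p'-x\| \text{ for all } p'\in P\}$, and the Voronoi tessellation is $\Upsilon(P)=\{V(p) : p\in P\}$. A point is a Voronoi vertex of $\Upsilon(P)$ if it is the (one-point) intersection of three or more Voronoi polygons of $\Upsilon(P)$. The Voronoi iteration $\nu(P)$ is the set of all Voronoi vertices of $\Upsilon(P)$. $|\cdot|$ denotes cardinality. $\mathrm{Bd}(P)=P\cap\partial CH(P)$, where $CH(P)$ is the convex hull of $P$ and $\partial CH(P)$ its topological boundary in $\mathbb{R}^2$ (so points of $P$ lying in the relative interior of a side of the hull are included in $\mathrm{Bd}(P)$). An empty circle of $P$ is a circle whose interior (open disc) contains no point of $P$ and which itself passes through three or more points of $P$. If $C_1,\dots,C_k$ are all the empty circles of $P$, the number of instances of cocircularity of $P$ is $I_c(P)=\sum_{i=1}^k\left(|C_i\cap P|-3\right)$. *)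

theory Defs
  imports "HOL-Analysis.Analysis"
begin

definition voronoi_polygon :: "(real^2) set \<Rightarrow> real^2 \<Rightarrow> (real^2) set" where
  "voronoi_polygon P p = {x. \<forall>p'\<in>P. norm (p - x) \<le> norm (p' - x)}"

definition voronoi_tessellation :: "(real^2) set \<Rightarrow> (real^2) set set" where
  "voronoi_tessellation P = voronoi_polygon P ` P"

definition voronoi_vertex :: "(real^2) set \<Rightarrow> real^2 \<Rightarrow> bool" where
  "voronoi_vertex P x \<longleftrightarrow>
     (\<exists>S \<subseteq> voronoi_tessellation P. card S \<ge> 3 \<and> \<Inter>S = {x})"

definition voronoi_iteration :: "(real^2) set \<Rightarrow> (real^2) set" where
  "voronoi_iteration P = {x. voronoi_vertex P x}"

(* The frontier is taken in the plane, so points of P in the relative interior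
   of a side of the hull are included. *)
definition Bd :: "(real^2) set \<Rightarrow> (real^2) set" where
  "Bd P = P \<inter> frontier (convex hull P)"

(* A circle is a set of points, so each circle is counted once in the sum below. *)
definition empty_circle :: "(real^2) set \<Rightarrow> (real^2) set \<Rightarrow> bool" where
  "empty_circle P C \<longleftrightarrow>
     (\<exists>c r. r > 0 \<and> C = sphere c r \<and> ball c r \<inter> P = {}) \<and> card (C \<inter> P) \<ge> 3"

(* For finite P there are only finitely many empty circles, a circle being
   determined by any three of its points; the sum is therefore never the
   default value for an infinite index set. *)
definition cocircularity :: "(real^2) set \<Rightarrow> int" where
  "cocircularity P = (\<Sum>C\<in>{C. empty_circle P C}. (int (card (C \<inter> P)) - 3))"

end

theory Submission
  imports Defs
begin

text \<open>
  A Voronoi vertex is the centre of an empty circle, and the points of \<open>P\<close> on that circle are its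
  nearest sites \<open>N c\<close>. Writing the cocircularity as \<open>\<Sum>(card (N c) - 3)\<close> over the Voronoi vertices
  \<open>c\<close>, the claim becomes
  \<open>\<Sum>(card (N c) - 2) = 2 * card P - card (Bd P) - 2\<close>. Here \<open>card (N c) - 2\<close> is the number
  of triangles into which the Delaunay cell of \<open>c\<close>, the convex hull of \<open>N c\<close>, can be cut. The proof
  counts horizontal rays instead of triangles.

  Fix a direction \<open>h\<close> to which no line through two points of \<open>P\<close> is parallel; call \<open>h\<close> horizontal.
  For a non-collinear \<open>Q \<subseteq> P\<close>, count the pairs of a point \<open>p\<close> of \<open>Q\<close> and a direction \<open>d\<close> in \<open>{h, - h}\<close> such
  that the ray from \<open>p\<close> in direction \<open>d\<close> starts inside the convex hull of \<open>Q\<close>. A point in the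
  interior of the hull contributes 2, the highest and the lowest point contribute 0, and every other
  boundary point contributes 1; so the count is \<open>2 * card Q - card (Bd Q) - 2\<close>
  (lemma \<open>points_into_total\<close>). All points of \<open>N c\<close> lie on the boundary of their hull,
  so for \<open>Q = N c\<close> the count is \<open>card (N c) - 2\<close>.

  It remains to see that the count for \<open>P\<close> is the sum of the counts for the sets \<open>N c\<close>, that is: a ray
  that enters the hull of \<open>P\<close> at \<open>p\<close> enters the hull of exactly one \<open>N c\<close> with \<open>p \<in> N c\<close>
  (lemma \<open>points_into_nearest_count\<close>). This is linear programming duality. The Voronoi polygon of
  \<open>p\<close> is cut out by the inequalities \<open>2 * ((q - p) \<bullet> x) \<le> q \<bullet> q - p \<bullet> p\<close>, and the ray in direction
  \<open>d\<close> enters the hull of \<open>N c\<close> when \<open>d\<close> is a positive combination of the normals \<open>q - p\<close> of the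
  inequalities tight at \<open>c\<close>, that is, when \<open>c\<close> maximises \<open>d\<close> on the polygon. Since
  \<open>d\<close> is generic, the maximiser is unique. It exists when \<open>d\<close> is a positive combination of arbitrary
  normals, as the simplex method shows: among the pairs of normals that represent \<open>d\<close>,
  the pair with the smallest dual value has a feasible vertex.
\<close>

section \<open>Plane geometry\<close>

definition perp :: "real^2 \<Rightarrow> real^2" where
  "perp v = vector [- v$2, v$1]"

lemma inner_real2: "(x::real^2) \<bullet> y = x$1 * y$1 + x$2 * y$2"
  by (simp add: inner_vec_def sum_2)

lemma perp_nth [simp]: "perp v $ 1 = - v$2" "perp v $ 2 = v$1"
  by (simp_all add: perp_def vector_2)

lemma perp_minus: "perp (- v) = - perp v"
  by (simp add: vec_eq_iff forall_2)

lemma perp_inner_self [simp]: "perp v \<bullet> v = 0"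
  by (simp add: inner_real2)

lemma eq_0_iff_real2: "(v::real^2) = 0 \<longleftrightarrow> v$1 = 0 \<and> v$2 = 0"
  by (simp add: vec_eq_iff forall_2)

lemma perp_eq_0_iff [simp]: "perp v = 0 \<longleftrightarrow> v = 0"
  by (auto simp: eq_0_iff_real2)

lemma orthogonal_perp_imp_parallel:
  assumes "h \<noteq> 0" "perp h \<bullet> x = 0"
  shows "\<exists>t. x = t *\<^sub>R h"
proof
  have n: "h$1 * h$1 + h$2 * h$2 \<noteq> 0"
    using assms(1) by (simp add: eq_0_iff_real2 sum_squares_eq_zero_iff)
  have o: "h$1 * x$2 = h$2 * x$1"
    using assms(2) by (simp add: inner_real2)
  have "x$1 * (h$1 * h$1 + h$2 * h$2) = (x$1 * h$1 + x$2 * h$2) * h$1"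
       "x$2 * (h$1 * h$1 + h$2 * h$2) = (x$1 * h$1 + x$2 * h$2) * h$2"
    using o by algebra+
  with n show "x = ((x \<bullet> h) / (h \<bullet> h)) *\<^sub>R h"
    by (simp add: vec_eq_iff forall_2 inner_real2 divide_simps)
qed

lemma linear_system_real2:
  fixes a b :: "real^2"
  assumes "perp a \<bullet> b \<noteq> 0"
  shows "\<exists>c. a \<bullet> c = s \<and> b \<bullet> c = t"
proof -
  define D where "D = perp a \<bullet> b"
  have D: "D \<noteq> 0" "D = a$1 * b$2 - a$2 * b$1"
    using assms by (simp_all add: D_def inner_real2)
  define c :: "real^2" where "c = vector [(s * b$2 - t * a$2) / D, (a$1 * t - b$1 * s) / D]"
  have "a \<bullet> c = s" "b \<bullet> c = t"
    using D(1) unfolding c_def inner_real2 vector_2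
    by (simp_all add: divide_simps) (simp_all add: D(2) algebra_simps)
  then show ?thesis by blast
qed

lemma linear_system_real2_unique:
  fixes a b :: "real^2"
  assumes "perp a \<bullet> b \<noteq> 0" "a \<bullet> c = a \<bullet> d" "b \<bullet> c = b \<bullet> d"
  shows "c = d"
proof -
  have "(a$1 * b$2 - a$2 * b$1) * (c$1 - d$1) = 0" "(a$1 * b$2 - a$2 * b$1) * (c$2 - d$2) = 0"
    using assms(2,3) unfolding inner_real2 by algebra+
  with assms(1) show ?thesis
    by (auto simp: vec_eq_iff forall_2 inner_real2)
qed

text \<open>
  Among the directions \<open>(m, -1)\<close>, each pair of distinct points rules out at most one \<open>m\<close>: the
  negated ratio of its coordinate differences, or none (the quotient by 0 only removes the
  harmless value 0) when the second coordinates agree.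
\<close>

lemma exists_generic_direction:
  fixes P :: "(real^2) set"
  assumes "finite P"
  shows "\<exists>h. h \<noteq> 0 \<and> inj_on (inner (perp h)) P"
proof -
  let ?bad = "(\<lambda>(p, q). - (p$1 - q$1) / (p$2 - q$2)) ` (P \<times> P)"
  have "finite ?bad" using assms by simp
  then obtain m where m: "m \<notin> ?bad"
    using ex_new_if_finite infinite_UNIV_char_0 by blast
  define h :: "real^2" where "h = vector [m, -1]"
  have "inj_on (inner (perp h)) P"
  proof (rule inj_onI)
    fix p q assume pq: "p \<in> P" "q \<in> P" "perp h \<bullet> p = perp h \<bullet> q"
    have eq: "p$1 - q$1 + m * (p$2 - q$2) = 0"
      using pq(3) by (simp add: inner_real2 h_def vector_2 algebra_simps)
    have "p$2 = q$2"
    proof (rule ccontr)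
      assume "p$2 \<noteq> q$2"
      then have "m = - (p$1 - q$1) / (p$2 - q$2)"
        using eq by (simp add: field_simps)
      with pq(1,2) m show False by force
    qed
    with eq show "p = q" by (simp add: vec_eq_iff forall_2)
  qed
  moreover have "h \<noteq> 0" by (simp add: h_def eq_0_iff_real2 vector_2)
  ultimately show ?thesis by blast
qed

lemma noncollinear_orthogonal_imp_0:
  fixes Q :: "(real^2) set"
  assumes "\<not> collinear Q" "\<And>x y. x \<in> Q \<Longrightarrow> y \<in> Q \<Longrightarrow> w \<bullet> (x - y) = 0"
  shows "w = 0"
proof (rule ccontr)
  assume "w \<noteq> 0"
  then have "\<exists>t. x - y = t *\<^sub>R perp w" if "x \<in> Q" "y \<in> Q" for x y
    using orthogonal_perp_imp_parallel[of "perp w" "x - y"] assms(2)[OF that]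
    by (simp add: inner_real2)
  then have "collinear Q" unfolding collinear_def by blast
  with assms(1) show False by blast
qed

text \<open>
  Comparing distances from \<open>c\<close> to two fixed points is linear in \<open>c\<close>. This makes a Voronoi
  polygon the feasible region of a linear program.
\<close>

lemma dist_le_iff_inner:
  fixes c p q :: "'a::real_inner"
  shows "dist c p \<le> dist c q \<longleftrightarrow> 2 * ((q - p) \<bullet> c) \<le> q \<bullet> q - p \<bullet> p"
  by (simp add: dist_norm norm_le algebra_simps inner_commute)

lemma dist_eq_iff_inner:
  fixes c p q :: "'a::real_inner"
  shows "dist c q = dist c p \<longleftrightarrow> 2 * ((q - p) \<bullet> c) = q \<bullet> q - p \<bullet> p"
  using dist_le_iff_inner[of c p q] dist_le_iff_inner[of c q p]
  by (auto simp: algebra_simps)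

text \<open>
  The tangent at a point of a sphere touches the closed ball nowhere else.
\<close>

lemma inner_sphere_normal_neg:
  fixes c p x :: "'a::real_inner"
  assumes "dist c x \<le> dist c p" "x \<noteq> p"
  shows "(p - c) \<bullet> (x - p) < 0"
proof -
  have "0 < (x - p) \<bullet> (x - p)" using assms(2) by simp
  with assms(1) show ?thesis
    unfolding dist_le_iff_inner by (simp add: algebra_simps inner_commute)
qed

text \<open>
  Along a line, the squared distance to \<open>c\<close> is a quadratic polynomial with non-zero leading
  coefficient, so it takes no value at three points.
\<close>

lemma not_collinear_on_sphere:
  fixes c :: "'a::real_inner"
  assumes "card Q \<ge> 3" "\<And>x y. x \<in> Q \<Longrightarrow> y \<in> Q \<Longrightarrow> dist c x = dist c y"
  shows "\<not> collinear Q"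
proof
  assume "collinear Q"
  then obtain d where d: "\<And>x y. x \<in> Q \<Longrightarrow> y \<in> Q \<Longrightarrow> \<exists>t. x - y = t *\<^sub>R d"
    unfolding collinear_def by blast
  obtain T where T: "T \<subseteq> Q" "card T = 3"
    using assms(1) by (metis obtain_subset_with_card_n)
  then obtain x y z where xyz: "T = {x, y, z}" "x \<noteq> y" "x \<noteq> z" "y \<noteq> z"
    by (auto simp: card_3_iff)
  obtain s t where st: "y - x = s *\<^sub>R d" "z - x = t *\<^sub>R d"
    using d[of y x] d[of z x] T(1) xyz(1) by auto
  have root: "2 * ((x - c) \<bullet> d) + r * (d \<bullet> d) = 0" if "v \<in> Q" "v - x = r *\<^sub>R d" "v \<noteq> x" for v r
  proof -
    have v: "v = x + r *\<^sub>R d" using that(2) by (simp add: algebra_simps)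
    have "r \<noteq> 0" using v that(3) by auto
    have "dist c v = dist c x" by (rule assms(2)) (use that(1) T(1) xyz(1) in auto)
    then have "r * (2 * ((x - c) \<bullet> d) + r * (d \<bullet> d)) = 0"
      unfolding dist_eq_iff_inner v by (simp add: algebra_simps inner_commute)
    with \<open>r \<noteq> 0\<close> show ?thesis by simp
  qed
  have "s * (d \<bullet> d) = t * (d \<bullet> d)"
  proof -
    have "y \<in> Q" "z \<in> Q" using T(1) xyz(1) by auto
    then show ?thesis
      using root[OF _ st(1)] root[OF _ st(2)] xyz(2,3) by (metis add_left_cancel)
  qed
  moreover have "d \<noteq> 0" using st(1) xyz(2) by auto
  ultimately have "s = t" by (metis inner_eq_zero_iff mult_right_cancel)
  with st have "y - x = z - x" by simp
  with xyz(4) show False by simp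
qed

section \<open>Voronoi vertices and empty circles\<close>

definition nearest :: "(real^2) set \<Rightarrow> real^2 \<Rightarrow> (real^2) set" where
  "nearest P c = {p \<in> P. \<forall>q\<in>P. dist c p \<le> dist c q}"

lemma nearest_subset: "nearest P c \<subseteq> P"
  by (auto simp: nearest_def)

lemma nearest_equidistant: "p \<in> nearest P c \<Longrightarrow> q \<in> nearest P c \<Longrightarrow> dist c p = dist c q"
  by (auto simp: nearest_def intro: antisym)

lemma not_collinear_nearest: "card (nearest P c) \<ge> 3 \<Longrightarrow> \<not> collinear (nearest P c)"
  by (rule not_collinear_on_sphere) (auto intro: nearest_equidistant)

lemma voronoi_polygon_nearest:
  "p \<in> P \<Longrightarrow> x \<in> voronoi_polygon P p \<longleftrightarrow> p \<in> nearest P x"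
  by (auto simp: voronoi_polygon_def nearest_def dist_norm norm_minus_commute)

lemma inj_on_voronoi_polygon: "inj_on (voronoi_polygon P) P"
proof (rule inj_onI)
  fix p q assume "p \<in> P" "q \<in> P" "voronoi_polygon P p = voronoi_polygon P q"
  moreover have "p \<in> voronoi_polygon P p" by (simp add: voronoi_polygon_def)
  ultimately have "norm (q - p) \<le> norm (p - p)"
    by (metis (no_types, lifting) mem_Collect_eq voronoi_polygon_def)
  then show "p = q" by simp
qed

text \<open>
  The difference of two centres is orthogonal to all differences of points of \<open>Q\<close>.
\<close>

lemma equidistant_centre_unique:
  fixes Q :: "(real^2) set"
  assumes "\<not> collinear Q"
    "\<And>p q. p \<in> Q \<Longrightarrow> q \<in> Q \<Longrightarrow> dist c p = dist c q"
    "\<And>p q. p \<in> Q \<Longrightarrow> q \<in> Q \<Longrightarrow> dist d p = dist d q"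
  shows "c = d"
proof -
  have "(c - d) \<bullet> (p - q) = 0" if "p \<in> Q" "q \<in> Q" for p q
    using assms(2,3)[OF that] unfolding dist_eq_iff_inner
    by (simp add: algebra_simps inner_commute)
  then have "c - d = 0" by (rule noncollinear_orthogonal_imp_0[OF assms(1)])
  then show ?thesis by simp
qed

text \<open>
  Distinct sites have distinct polygons, so three polygons meeting in \<open>c\<close> are three nearest
  sites of \<open>c\<close>. Conversely, a point common to the polygons of all nearest sites of \<open>c\<close> is
  equidistant from at least three points of a circle, hence is its centre.
\<close>

lemma voronoi_iteration_eq:
  assumes "finite P"
  shows "voronoi_iteration P = {c. card (nearest P c) \<ge> 3}"
proof (rule set_eqI)
  fix c
  have "voronoi_vertex P c \<longleftrightarrow> card (nearest P c) \<ge> 3"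
  proof
    assume "voronoi_vertex P c"
    then obtain S where S: "S \<subseteq> voronoi_polygon P ` P" "card S \<ge> 3" "\<Inter>S = {c}"
      unfolding voronoi_vertex_def voronoi_tessellation_def by blast
    then obtain T where T: "T \<subseteq> P" "S = voronoi_polygon P ` T" by (auto simp: subset_image_iff)
    have "T \<subseteq> nearest P c"
    proof
      fix p assume "p \<in> T"
      then have "c \<in> voronoi_polygon P p" "p \<in> P" using S(3) T by auto
      then show "p \<in> nearest P c" by (simp add: voronoi_polygon_nearest)
    qed
    moreover have "card S \<le> card T"
      unfolding T(2) by (rule card_image_le[OF finite_subset[OF T(1) assms]])
    moreover have "finite (nearest P c)"
      by (rule finite_subset[OF nearest_subset assms])
    ultimately show "card (nearest P c) \<ge> 3"
      using S(2) card_mono[of "nearest P c" T] by linarith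
  next
    assume c3: "card (nearest P c) \<ge> 3"
    let ?S = "voronoi_polygon P ` nearest P c"
    have mem: "x \<in> \<Inter>?S \<longleftrightarrow> nearest P c \<subseteq> nearest P x" for x
    proof -
      have "x \<in> \<Inter>?S \<longleftrightarrow> (\<forall>p\<in>nearest P c. x \<in> voronoi_polygon P p)" by simp
      also have "\<dots> \<longleftrightarrow> (\<forall>p\<in>nearest P c. p \<in> nearest P x)"
        using nearest_subset by (intro ball_cong refl voronoi_polygon_nearest) blast
      finally show ?thesis by blast
    qed
    have "x = c" if "nearest P c \<subseteq> nearest P x" for x
    proof (rule equidistant_centre_unique[OF not_collinear_nearest[OF c3]])
      fix p q assume "p \<in> nearest P c" "q \<in> nearest P c"
      then show "dist x p = dist x q" "dist c p = dist c q"
        using that by (auto intro!: nearest_equidistant[of _ P])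
    qed
    then have "\<Inter>?S = {c}" by (intro set_eqI) (unfold mem, auto)
    moreover have "card ?S \<ge> 3"
      using c3 card_image[OF inj_on_subset[OF inj_on_voronoi_polygon nearest_subset]] by metis
    moreover have "?S \<subseteq> voronoi_tessellation P"
      unfolding voronoi_tessellation_def using nearest_subset by blast
    ultimately show "voronoi_vertex P c" unfolding voronoi_vertex_def by blast
  qed
  then show "c \<in> voronoi_iteration P \<longleftrightarrow> c \<in> {c. card (nearest P c) \<ge> 3}"
    by (simp add: voronoi_iteration_def)
qed

lemma inj_on_nearest: "inj_on (nearest P) {c. card (nearest P c) \<ge> 3}"
proof (rule inj_onI)
  fix c d assume c: "c \<in> {c. card (nearest P c) \<ge> 3}" and eq: "nearest P c = nearest P d"
  from c have "\<not> collinear (nearest P c)" by (simp add: not_collinear_nearest)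
  then show "c = d"
  proof (rule equidistant_centre_unique)
    fix p q assume "p \<in> nearest P c" "q \<in> nearest P c"
    then show "dist c p = dist c q" "dist d p = dist d q"
      using eq by (auto intro: nearest_equidistant[of _ P])
  qed
qed

text \<open>
  A Voronoi vertex is determined by its nearest sites, and \<open>P\<close> has finitely many subsets.
\<close>

lemma finite_voronoi_vertices:
  assumes "finite P"
  shows "finite {c. card (nearest P c) \<ge> 3}"
proof (rule inj_on_finite[OF inj_on_nearest])
  show "nearest P ` {c. card (nearest P c) \<ge> 3} \<subseteq> Pow P" using nearest_subset by blast
  show "finite (Pow P)" using assms by simp
qed

lemma empty_circle_Int_eq_nearest:
  assumes "ball c r \<inter> P = {}" "sphere c r \<inter> P \<noteq> {}"
  shows "sphere c r \<inter> P = nearest P c"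
proof -
  have out: "r \<le> dist c q" if "q \<in> P" for q
    using assms(1) that by (auto simp: disjoint_iff not_less)
  obtain p where p: "p \<in> P" "dist c p = r" using assms(2) by fastforce
  have "dist c q = r \<longleftrightarrow> (\<forall>q'\<in>P. dist c q \<le> dist c q')" if "q \<in> P" for q
    using out that p by (metis order_antisym)
  then show ?thesis by (auto simp: nearest_def)
qed

text \<open>
  Mapping a Voronoi vertex to the circle around it through its nearest sites is a bijection onto
  the empty circles.
\<close>

lemma cocircularity_eq:
  assumes "finite P"
  shows "cocircularity P = (\<Sum>c\<in>{c. card (nearest P c) \<ge> 3}. int (card (nearest P c)) - 3)"
proof -
  let ?V = "{c. card (nearest P c) \<ge> 3}"
  let ?circle = "\<lambda>c. sphere c (infdist c P)"
  have rad: "infdist c P = dist c p" if "p \<in> nearest P c" for c p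
  proof (rule antisym)
    show "infdist c P \<le> dist c p" using that by (auto simp: nearest_def intro: infdist_le)
    show "dist c p \<le> infdist c P"
      using that unfolding nearest_def infdist_def by (auto intro: cINF_greatest)
  qed
  have circ: "?circle c \<inter> P = nearest P c \<and> infdist c P > 0 \<and> ball c (infdist c P) \<inter> P = {}"
    if "c \<in> ?V" for c
  proof -
    obtain T where "T \<subseteq> nearest P c" "card T = 2"
      using \<open>c \<in> ?V\<close> obtain_subset_with_card_n[of 2 "nearest P c"] by auto
    then obtain p q where p: "p \<in> nearest P c" "q \<in> nearest P c" "p \<noteq> q"
      by (auto simp: card_2_iff)
    have ball: "ball c (infdist c P) \<inter> P = {}" using infdist_le[of _ P c] by (force simp: not_less)
    have "dist c p = dist c q" using p nearest_equidistant by blast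
    then have "infdist c P > 0" using rad[OF p(1)] p(3) by (metis dist_eq_0_iff zero_less_dist_iff)
    moreover have "p \<in> ?circle c \<inter> P" using p(1) rad[OF p(1)] by (simp add: nearest_def)
    then have "?circle c \<inter> P = nearest P c"
      by (intro empty_circle_Int_eq_nearest[OF ball]) blast
    ultimately show ?thesis using ball by blast
  qed
  have "bij_betw ?circle ?V {C. empty_circle P C}"
  proof (rule bij_betwI')
    fix c d assume c: "c \<in> ?V" and d: "d \<in> ?V"
    show "?circle c = ?circle d \<longleftrightarrow> c = d"
      using circ[OF c] circ[OF d] inj_onD[OF inj_on_nearest _ c d] by metis
  next
    fix c assume "c \<in> ?V"
    then show "?circle c \<in> {C. empty_circle P C}"
      using circ[of c] by (auto simp: empty_circle_def)
  next
    fix C assume "C \<in> {C. empty_circle P C}"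
    then obtain c r where cr: "C = sphere c r" "ball c r \<inter> P = {}" "card (C \<inter> P) \<ge> 3"
      by (auto simp: empty_circle_def)
    then have "C \<inter> P \<noteq> {}" by auto
    then obtain p where p: "p \<in> C \<inter> P" by blast
    have "C \<inter> P = nearest P c"
      using empty_circle_Int_eq_nearest[of c r P] cr(1,2) p by blast
    then have "c \<in> ?V" "infdist c P = r" using cr rad[of p c] p by auto
    then show "\<exists>c\<in>?V. C = ?circle c" using cr(1) by blast
  qed
  then have "cocircularity P = (\<Sum>c\<in>?V. int (card (?circle c \<inter> P)) - 3)"
    unfolding cocircularity_def by (rule sum.reindex_bij_betw[symmetric])
  also have "\<dots> = (\<Sum>c\<in>?V. int (card (nearest P c)) - 3)"
    using circ by (intro sum.cong) auto
  finally show ?thesis .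
qed

section \<open>Horizontal rays into the hull of a finite set\<close>

definition intermediate :: "real^2 \<Rightarrow> (real^2) set \<Rightarrow> real^2 \<Rightarrow> bool" where
  "intermediate u Q p \<longleftrightarrow> (\<exists>a\<in>Q. u \<bullet> p < u \<bullet> a) \<and> (\<exists>b\<in>Q. u \<bullet> b < u \<bullet> p)"

text \<open>
  For non-zero \<open>h\<close> not parallel to \<open>q - p\<close> for any \<open>q \<noteq> p\<close> in \<open>Q\<close>, this says that the ray from \<open>p\<close> in
  direction \<open>h\<close> starts in the interior of the convex hull of \<open>Q\<close>: by Caratheodory's theorem for
  cones, two generators suffice in the plane.
\<close>

definition points_into :: "(real^2) set \<Rightarrow> real^2 \<Rightarrow> real^2 \<Rightarrow> bool" where
  "points_into Q p h \<longleftrightarrow>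
     (\<exists>a\<in>Q. \<exists>b\<in>Q. \<exists>\<alpha>>0. \<exists>\<beta>>0. h = \<alpha> *\<^sub>R (a - p) + \<beta> *\<^sub>R (b - p))"

lemma intermediate_uminus [simp]: "intermediate (- u) Q p \<longleftrightarrow> intermediate u Q p"
  by (auto simp: intermediate_def)

lemma inj_on_inner_uminus: "inj_on (inner (- u)) Q \<longleftrightarrow> inj_on (inner u) Q"
  by (simp add: inj_on_def)

lemma finite_has_maximizer:
  fixes f :: "'a \<Rightarrow> real"
  assumes "finite A" "A \<noteq> {}"
  shows "\<exists>a\<in>A. \<forall>x\<in>A. f x \<le> f a"
proof -
  have "Max (f ` A) \<in> f ` A" using assms by simp
  then obtain a where "a \<in> A" "f a = Max (f ` A)" by auto
  then show ?thesis using assms(1) by (intro bexI[of _ a]) auto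
qed

text \<open>
  Only the unique highest and the unique lowest point are not intermediate.
\<close>

lemma card_intermediate:
  assumes "finite Q" "inj_on (inner u) Q" "card Q \<ge> 2"
  shows "card {p \<in> Q. intermediate u Q p} = card Q - 2"
proof -
  have ne: "Q \<noteq> {}" using assms(3) by auto
  obtain t where t: "t \<in> Q" "\<And>q. q \<in> Q \<Longrightarrow> u \<bullet> q \<le> u \<bullet> t"
    using finite_has_maximizer[OF assms(1) ne, of "inner u"] by blast
  obtain b where b: "b \<in> Q" "\<And>q. q \<in> Q \<Longrightarrow> u \<bullet> b \<le> u \<bullet> q"
    using finite_has_maximizer[OF assms(1) ne, of "\<lambda>q. - (u \<bullet> q)"] by auto
  have "b \<noteq> t"
  proof
    assume "b = t"
    have "q = t" if "q \<in> Q" for q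
    proof (rule inj_onD[OF assms(2) _ that t(1)])
      show "u \<bullet> q = u \<bullet> t"
        using t(2)[OF that] b(2)[OF that] unfolding \<open>b = t\<close> by (rule antisym)
    qed
    then have "card Q \<le> card {t}" by (intro card_mono) auto
    with assms(3) show False by simp
  qed
  have "{p \<in> Q. intermediate u Q p} = Q - {t, b}"
  proof (intro set_eqI iffI)
    fix p assume "p \<in> {p \<in> Q. intermediate u Q p}"
    then show "p \<in> Q - {t, b}"
      using t(2) b(2) by (force simp: intermediate_def)
  next
    fix p assume p: "p \<in> Q - {t, b}"
    then have "u \<bullet> p \<noteq> u \<bullet> t" "u \<bullet> p \<noteq> u \<bullet> b"
      using inj_onD[OF assms(2)] t(1) b(1) by blast+
    then have "u \<bullet> p < u \<bullet> t" "u \<bullet> b < u \<bullet> p"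
      using t(2)[of p] b(2)[of p] p by auto
    then show "p \<in> {p \<in> Q. intermediate u Q p}"
      using p t(1) b(1) by (auto simp: intermediate_def)
  qed
  moreover have "card (Q - {t, b}) = card Q - card {t, b}"
    by (rule card_Diff_subset) (use t(1) b(1) in auto)
  ultimately show ?thesis using \<open>b \<noteq> t\<close> by simp
qed

text \<open>
  The segment between two points on opposite sides of the line spanned by \<open>h\<close> crosses that line.
\<close>

lemma opposite_sides_combination:
  assumes "h \<noteq> 0" "(perp h \<bullet> a) * (perp h \<bullet> b) < 0"
  shows "\<exists>\<alpha>>0. \<exists>\<beta>>0. \<exists>t. \<alpha> *\<^sub>R a + \<beta> *\<^sub>R b = t *\<^sub>R h"
proof -
  let ?\<alpha> = "\<bar>perp h \<bullet> b\<bar>" and ?\<beta> = "\<bar>perp h \<bullet> a\<bar>"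
  have "perp h \<bullet> (?\<alpha> *\<^sub>R a + ?\<beta> *\<^sub>R b) = 0"
    using assms(2) by (auto simp: inner_add_right mult_less_0_iff)
  then have "\<exists>t. ?\<alpha> *\<^sub>R a + ?\<beta> *\<^sub>R b = t *\<^sub>R h"
    by (rule orthogonal_perp_imp_parallel[OF assms(1)])
  moreover have "?\<alpha> > 0" "?\<beta> > 0" using assms(2) by auto
  ultimately show ?thesis by blast
qed

text \<open>
  The heights of \<open>a\<close> and \<open>b\<close> above \<open>p\<close> have a positive combination equal to 0, so they have
  opposite signs unless both vanish; then injectivity makes \<open>a\<close> and \<open>b\<close> equal to \<open>p\<close>.
\<close>

lemma combination_opposite_sides:
  assumes "h \<noteq> 0" "inj_on (inner (perp h)) Q" "p \<in> Q" "a \<in> Q" "b \<in> Q"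
    and "\<alpha> > 0" "\<beta> > 0" "h = \<alpha> *\<^sub>R (a - p) + \<beta> *\<^sub>R (b - p)"
  shows "(perp h \<bullet> (a - p)) * (perp h \<bullet> (b - p)) < 0"
proof -
  define y where "y q = perp h \<bullet> (q - p)" for q
  have eq_p: "q = p" if "q \<in> Q" "y q = 0" for q
    using inj_onD[OF assms(2) _ that(1) assms(3)] that(2) by (simp add: y_def inner_diff_right)
  have "perp h \<bullet> (\<alpha> *\<^sub>R (a - p) + \<beta> *\<^sub>R (b - p)) = 0"
    using assms(8) perp_inner_self[of h] by metis
  then have comb: "\<alpha> * y a + \<beta> * y b = 0"
    by (simp add: y_def inner_add_right)
  have "y a \<noteq> 0"
  proof
    assume "y a = 0"
    with comb assms(7) have "y b = 0" by simp
    with \<open>y a = 0\<close> have "a = p" "b = p" using eq_p assms(4,5) by blast+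
    with assms(8) have "h = 0" by (metis add_0 diff_self scaleR_zero_right)
    with assms(1) show False ..
  qed
  have "\<beta> * (y a * y b) = - (\<alpha> * (y a * y a))"
    using comb by algebra
  also have "\<dots> < 0" using assms(6) \<open>y a \<noteq> 0\<close> by (simp add: zero_less_mult_iff) linarith
  finally show ?thesis using assms(7) by (simp add: y_def mult_less_0_iff)
qed

lemma combination_independent:
  assumes "h \<noteq> 0" "inj_on (inner (perp h)) Q" "p \<in> Q" "a \<in> Q" "b \<in> Q"
    and "\<alpha> > 0" "\<beta> > 0" "h = \<alpha> *\<^sub>R (a - p) + \<beta> *\<^sub>R (b - p)"
  shows "perp (a - p) \<bullet> (b - p) \<noteq> 0"
proof -
  have "perp h \<bullet> (b - p) = \<alpha> * (perp (a - p) \<bullet> (b - p))"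
    unfolding assms(8) by (simp add: inner_real2 algebra_simps)
  then show ?thesis using combination_opposite_sides[OF assms] by auto
qed

lemma points_into_opposite_sides:
  assumes "h \<noteq> 0" "inj_on (inner (perp h)) Q" "p \<in> Q" "points_into Q p h"
  obtains a b \<alpha> \<beta> where "a \<in> Q" "b \<in> Q" "\<alpha> > 0" "\<beta> > 0"
    "h = \<alpha> *\<^sub>R (a - p) + \<beta> *\<^sub>R (b - p)" "perp h \<bullet> (a - p) > 0" "perp h \<bullet> (b - p) < 0"
proof -
  obtain a b \<alpha> \<beta> where ab: "a \<in> Q" "b \<in> Q" "\<alpha> > 0" "\<beta> > 0"
    "h = \<alpha> *\<^sub>R (a - p) + \<beta> *\<^sub>R (b - p)"
    using assms(4) by (auto simp: points_into_def)
  have "(perp h \<bullet> (a - p)) * (perp h \<bullet> (b - p)) < 0"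
    by (rule combination_opposite_sides[OF assms(1-3) ab])
  then consider "perp h \<bullet> (a - p) > 0" "perp h \<bullet> (b - p) < 0"
    | "perp h \<bullet> (b - p) > 0" "perp h \<bullet> (a - p) < 0"
    by (auto simp: mult_less_0_iff)
  then show thesis
  proof cases
    case 1
    show thesis by (rule that[OF ab 1])
  next
    case 2
    have "h = \<beta> *\<^sub>R (b - p) + \<alpha> *\<^sub>R (a - p)" using ab(5) by (simp add: add.commute)
    from that[OF ab(2,1,4,3) this 2] show thesis .
  qed
qed

lemma points_into_imp_intermediate:
  assumes "h \<noteq> 0" "inj_on (inner (perp h)) Q" "p \<in> Q" "points_into Q p h"
  shows "intermediate (perp h) Q p"
  using assms
  by (rule points_into_opposite_sides) (auto simp: intermediate_def inner_diff_right)

lemma points_into_imp_card_ge_3: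
  assumes "h \<noteq> 0" "inj_on (inner (perp h)) Q" "finite Q" "p \<in> Q" "points_into Q p h"
  shows "card Q \<ge> 3"
proof -
  obtain a b where ab: "a \<in> Q" "b \<in> Q" "perp h \<bullet> (a - p) > 0" "perp h \<bullet> (b - p) < 0"
    using points_into_opposite_sides[OF assms(1,2,4,5)] by metis
  then have "a \<noteq> p" "b \<noteq> p" "a \<noteq> b" by auto
  then have "card {a, b, p} = 3" by simp
  moreover have "card {a, b, p} \<le> card Q"
    using assms(3,4) ab(1,2) by (intro card_mono) auto
  ultimately show ?thesis by simp
qed

lemma positive_combination_rescale:
  fixes p h :: "'a::real_vector"
  assumes "\<alpha> > 0" "\<beta> > 0" "t > 0"
    "\<alpha> *\<^sub>R (a - p) + \<beta> *\<^sub>R (b - p) = t *\<^sub>R h"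
  shows "\<exists>\<alpha>'>0. \<exists>\<beta>'>0. h = \<alpha>' *\<^sub>R (a - p) + \<beta>' *\<^sub>R (b - p)"
proof -
  have "(1 / t) *\<^sub>R (t *\<^sub>R h) = (\<alpha> / t) *\<^sub>R (a - p) + (\<beta> / t) *\<^sub>R (b - p)"
    unfolding assms(4)[symmetric] by (simp add: scaleR_add_right)
  then have "h = (\<alpha> / t) *\<^sub>R (a - p) + (\<beta> / t) *\<^sub>R (b - p)" using assms(3) by simp
  moreover have "\<alpha> / t > 0" "\<beta> / t > 0" using assms by simp_all
  ultimately show ?thesis by blast
qed

text \<open>
  In coordinates \<open>x\<close> along \<open>h\<close> and \<open>y\<close> along \<open>perp h\<close>, take for \<open>m\<close> the largest slope \<open>x / y\<close>
  of the points above \<open>p\<close>. A point below \<open>p\<close> on the wrong side of the line \<open>x = m * y\<close> would,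
  together with a point above \<open>p\<close> that attains \<open>m\<close>, span a cone containing \<open>h\<close>.
\<close>

lemma supporting_line_if_not_points_into:
  assumes "finite Q" "h \<noteq> 0" "inj_on (inner (perp h)) Q" "p \<in> Q"
    and "intermediate (perp h) Q p" "\<not> points_into Q p h"
  shows "\<exists>m. \<forall>q\<in>Q. (h - m *\<^sub>R perp h) \<bullet> (q - p) \<le> 0"
proof -
  define x where "x q = h \<bullet> (q - p)" for q
  define y where "y q = perp h \<bullet> (q - p)" for q
  let ?U = "{a \<in> Q. y a > 0}"
  have "finite ?U" "?U \<noteq> {}"
    using assms(1,5) by (auto simp: y_def intermediate_def inner_diff_right)
  from finite_has_maximizer[OF this, of "\<lambda>q. x q / y q"]
  obtain a where aU: "a \<in> ?U" and max: "\<And>q. q \<in> ?U \<Longrightarrow> x q / y q \<le> x a / y a"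
    by blast
  have a: "a \<in> Q" "y a > 0" using aU by auto
  define m where "m = x a / y a"
  have xa: "x a = m * y a" using a(2) by (simp add: m_def)
  have "x q \<le> m * y q" if "q \<in> Q" for q
  proof (cases "y q" "0 :: real" rule: linorder_cases)
    case greater
    with max[of q] that have "x q / y q \<le> m" by (simp add: m_def)
    with greater show ?thesis by (simp add: pos_divide_le_eq)
  next
    case equal
    then have "q = p"
      using inj_onD[OF assms(3) _ that assms(4)] by (simp add: y_def inner_diff_right)
    then show ?thesis by (simp add: x_def y_def)
  next
    case less
    then have "(perp h \<bullet> (a - p)) * (perp h \<bullet> (q - p)) < 0"
      using a(2) by (simp add: y_def mult_less_0_iff)
    from opposite_sides_combination[OF assms(2) this]
    obtain \<alpha> \<beta> t where c: "\<alpha> > 0" "\<beta> > 0" "\<alpha> *\<^sub>R (a - p) + \<beta> *\<^sub>R (q - p) = t *\<^sub>R h"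
      by blast
    have "\<not> t > 0"
      using positive_combination_rescale[OF c(1,2) _ c(3)] assms(6) a(1) that
      by (auto simp: points_into_def)
    then have "t * (h \<bullet> h) \<le> 0" by (simp add: mult_le_0_iff)
    moreover have "\<alpha> * x a + \<beta> * x q = t * (h \<bullet> h)"
      using arg_cong[OF c(3), of "inner h"] by (simp add: x_def inner_add_right)
    moreover have "\<alpha> * y a + \<beta> * y q = 0"
      using arg_cong[OF c(3), of "inner (perp h)"] by (simp add: y_def inner_add_right)
    then have "\<alpha> * x a = - (m * (\<beta> * y q))" unfolding xa by algebra
    ultimately have "\<beta> * x q \<le> \<beta> * (m * y q)" by (simp add: algebra_simps)
    then show ?thesis using c(2) by simp
  qed
  then show ?thesis by (auto simp: x_def y_def inner_diff_left)
qed

text \<open>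
  When the hull has empty interior, all of it is frontier, and a hyperplane containing it supports
  it at every point.
\<close>

lemma frontier_convex_hull_iff_supporting_line:
  fixes Q :: "'a::euclidean_space set"
  assumes "p \<in> Q"
  shows "p \<in> frontier (convex hull Q) \<longleftrightarrow> (\<exists>v. v \<noteq> 0 \<and> (\<forall>q\<in>Q. v \<bullet> (q - p) \<le> 0))"
proof -
  have p: "p \<in> convex hull Q" using assms by (rule hull_inc)
  have "p \<in> frontier (convex hull Q) \<longleftrightarrow> p \<notin> interior (convex hull Q)"
    using p closure_subset[of "convex hull Q"] by (auto simp: frontier_def)
  also have "\<dots> \<longleftrightarrow> (\<exists>v. v \<noteq> 0 \<and> (\<forall>q\<in>Q. v \<bullet> (q - p) \<le> 0))"
  proof
    assume int: "p \<notin> interior (convex hull Q)"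
    show "\<exists>v. v \<noteq> 0 \<and> (\<forall>q\<in>Q. v \<bullet> (q - p) \<le> 0)"
    proof (cases "interior (convex hull Q) = {}")
      case True
      obtain a b where "a \<noteq> 0" "convex hull Q \<subseteq> {x. a \<bullet> x = b}"
        using empty_interior_subset_hyperplane[OF convex_convex_hull True] .
      then have "a \<bullet> q = b" if "q \<in> convex hull Q" for q using that by blast
      then have "\<forall>q\<in>Q. a \<bullet> (q - p) \<le> 0"
        using p hull_inc[of _ Q convex] by (simp add: inner_diff_right)
      then show ?thesis using \<open>a \<noteq> 0\<close> by blast
    next
      case False
      then have "p \<notin> rel_interior (convex hull Q)"
        using int rel_interior_nonempty_interior by blast
      then obtain a where a: "a \<noteq> 0" "\<And>y. y \<in> convex hull Q \<Longrightarrow> a \<bullet> p \<le> a \<bullet> y"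
        using supporting_hyperplane_rel_boundary[OF convex_convex_hull p] by metis
      then have "\<forall>q\<in>Q. (- a) \<bullet> (q - p) \<le> 0"
        using hull_inc[of _ Q convex] by (simp add: inner_diff_right)
      then show ?thesis using a(1) by (metis neg_equal_0_iff_equal)
    qed
  next
    assume "\<exists>v. v \<noteq> 0 \<and> (\<forall>q\<in>Q. v \<bullet> (q - p) \<le> 0)"
    then obtain v where v: "v \<noteq> 0" "\<And>q. q \<in> Q \<Longrightarrow> v \<bullet> q \<le> v \<bullet> p"
      by (auto simp: inner_diff_right)
    have "convex hull Q \<subseteq> {x. v \<bullet> x \<le> v \<bullet> p}"
      by (rule hull_minimal) (auto simp: v(2) convex_halfspace_le)
    then have "interior (convex hull Q) \<subseteq> {x. v \<bullet> x < v \<bullet> p}"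
      using interior_mono interior_halfspace_le[OF v(1)] by blast
    then show "p \<notin> interior (convex hull Q)" by auto
  qed
  finally show ?thesis .
qed

lemma Bd_iff_supporting_line:
  "p \<in> Q \<Longrightarrow> p \<in> Bd Q \<longleftrightarrow> (\<exists>v. v \<noteq> 0 \<and> (\<forall>q\<in>Q. v \<bullet> (q - p) \<le> 0))"
  by (simp add: Bd_def frontier_convex_hull_iff_supporting_line)

lemma points_into_inner_nonpos:
  assumes "points_into Q p h" "\<And>q. q \<in> Q \<Longrightarrow> v \<bullet> (q - p) \<le> 0"
  shows "v \<bullet> h \<le> 0"
proof -
  obtain a b \<alpha> \<beta> where "a \<in> Q" "b \<in> Q" "\<alpha> > 0" "\<beta> > 0"
    "h = \<alpha> *\<^sub>R (a - p) + \<beta> *\<^sub>R (b - p)"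
    using assms(1) by (auto simp: points_into_def)
  with assms(2) show ?thesis
    by (auto simp: inner_add_right intro!: add_nonpos_nonpos mult_nonneg_nonpos)
qed

text \<open>
  If neither ray enters the hull at an intermediate point, the two supporting lines of
  \<open>supporting_line_if_not_points_into\<close> have equal slopes, so \<open>Q\<close> lies on a line. If both rays
  enter, a supporting line at \<open>p\<close> would have to be horizontal, which is impossible with points of
  \<open>Q\<close> above and below \<open>p\<close>. Off \<open>Bd Q\<close> there is no supporting line at all, so \<open>p\<close> is
  intermediate and both rays enter.
\<close>

lemma points_into_count:
  assumes "finite Q" "\<not> collinear Q" "h \<noteq> 0" "inj_on (inner (perp h)) Q" "p \<in> Q"
  shows "(\<Sum>d\<in>{h, - h}. of_bool (points_into Q p d)) =
           (of_bool (intermediate (perp h) Q p) + of_bool (p \<notin> Bd Q) :: int)"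
proof -
  have inj': "inj_on (inner (perp (- h))) Q"
    using assms(4) by (simp add: perp_minus inj_on_inner_uminus)
  have intermediate: "intermediate (perp h) Q p" if "points_into Q p h \<or> points_into Q p (- h)"
    using that points_into_imp_intermediate[OF assms(3,4,5)]
      points_into_imp_intermediate[OF _ inj' assms(5)] assms(3)
    by (auto simp: perp_minus)
  have support: "\<exists>m. \<forall>q\<in>Q. (h - m *\<^sub>R perp h) \<bullet> (q - p) \<le> 0"
    if "intermediate (perp h) Q p" "\<not> points_into Q p h"
    using supporting_line_if_not_points_into[OF assms(1,3,4,5) that] .
  have support': "\<exists>m. \<forall>q\<in>Q. (h - m *\<^sub>R perp h) \<bullet> (q - p) \<ge> 0"
    if i: "intermediate (perp h) Q p" and n: "\<not> points_into Q p (- h)"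
  proof -
    obtain m where m: "\<forall>q\<in>Q. (- h - m *\<^sub>R perp (- h)) \<bullet> (q - p) \<le> 0"
      using supporting_line_if_not_points_into[OF assms(1) _ inj' assms(5) _ n] i assms(3)
      by (auto simp: perp_minus)
    have "- h - m *\<^sub>R perp (- h) = - (h - m *\<^sub>R perp h)" by (simp add: perp_minus)
    then have "\<forall>q\<in>Q. (h - m *\<^sub>R perp h) \<bullet> (q - p) \<ge> 0"
      using m by (metis inner_minus_left neg_le_0_iff_le)
    then show ?thesis ..
  qed
  have nz: "h - m *\<^sub>R perp h \<noteq> 0" for m
  proof
    assume "h - m *\<^sub>R perp h = 0"
    then have "(h - m *\<^sub>R perp h) \<bullet> h = 0" by simp
    then show False using assms(3) by (simp add: inner_diff_left)
  qed
  have one: "points_into Q p h \<or> points_into Q p (- h)" if i: "intermediate (perp h) Q p"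
  proof (rule ccontr)
    assume "\<not> ?thesis"
    then obtain m m' where m: "\<forall>q\<in>Q. (h - m *\<^sub>R perp h) \<bullet> (q - p) \<le> 0"
      and m': "\<forall>q\<in>Q. (h - m' *\<^sub>R perp h) \<bullet> (q - p) \<ge> 0"
      using support[OF i] support'[OF i] by blast
    obtain a b where a: "a \<in> Q" "perp h \<bullet> (a - p) > 0" and b: "b \<in> Q" "perp h \<bullet> (b - p) < 0"
      using i by (auto simp: intermediate_def inner_diff_right)
    have le: "m' * (perp h \<bullet> (q - p)) \<le> m * (perp h \<bullet> (q - p))" if "q \<in> Q" for q
      using bspec[OF m that] bspec[OF m' that] by (simp add: inner_diff_left)
    have "m = m'" using le[OF a(1)] le[OF b(1)] a(2) b(2) by simp
    then have zero: "(h - m *\<^sub>R perp h) \<bullet> (q - p) = 0" if "q \<in> Q" for q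
      using bspec[OF m that] bspec[OF m' that] by simp
    have "h - m *\<^sub>R perp h = 0"
    proof (rule noncollinear_orthogonal_imp_0[OF assms(2)])
      fix x y assume "x \<in> Q" "y \<in> Q"
      from zero[OF this(1)] zero[OF this(2)]
      show "(h - m *\<^sub>R perp h) \<bullet> (x - y) = 0" by (simp add: inner_diff_right)
    qed
    with nz show False by blast
  qed
  have both: "p \<notin> Bd Q" if pos: "points_into Q p h" and neg: "points_into Q p (- h)"
  proof
    assume "p \<in> Bd Q"
    then obtain v where v: "v \<noteq> 0" "\<And>q. q \<in> Q \<Longrightarrow> v \<bullet> (q - p) \<le> 0"
      using Bd_iff_supporting_line[OF assms(5)] by blast
    have "v \<bullet> h = 0"
      using points_into_inner_nonpos[OF pos v(2)] points_into_inner_nonpos[OF neg v(2)]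
      by simp
    moreover have "perp (perp h) \<bullet> v = - (v \<bullet> h)" by (simp add: inner_real2)
    ultimately have "perp (perp h) \<bullet> v = 0" by simp
    then obtain t where t: "v = t *\<^sub>R perp h"
      using orthogonal_perp_imp_parallel[of "perp h" v] assms(3) by auto
    obtain a b where "a \<in> Q" "perp h \<bullet> (a - p) > 0" "b \<in> Q" "perp h \<bullet> (b - p) < 0"
      using intermediate pos by (auto simp: intermediate_def inner_diff_right)
    then have "t = 0" using v(2)[of a] v(2)[of b] by (simp add: t mult_le_0_iff)
    with t v(1) show False by simp
  qed
  have interior: "intermediate (perp h) Q p \<and> points_into Q p h \<and> points_into Q p (- h)"
    if "p \<notin> Bd Q"
  proof -
    have no_line: "\<exists>q\<in>Q. v \<bullet> (q - p) > 0" if "v \<noteq> 0" for v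
      using that \<open>p \<notin> Bd Q\<close> Bd_iff_supporting_line[OF assms(5)] by (meson not_le)
    have i: "intermediate (perp h) Q p"
      using no_line[of "perp h"] no_line[of "- perp h"] assms(3)
      by (auto simp: intermediate_def inner_diff_right)
    have "points_into Q p h"
      using support[OF i] no_line[OF nz] by (meson not_le)
    moreover have "points_into Q p (- h)"
    proof (rule ccontr)
      assume "\<not> ?thesis"
      then obtain m where m: "\<forall>q\<in>Q. (h - m *\<^sub>R perp h) \<bullet> (q - p) \<ge> 0"
        using support'[OF i] by blast
      obtain q where "q \<in> Q" "(- (h - m *\<^sub>R perp h)) \<bullet> (q - p) > 0"
        using no_line[of "- (h - m *\<^sub>R perp h)"] nz[of m] by (metis neg_equal_0_iff_equal)
      with m show False by (metis inner_minus_left neg_0_less_iff_less not_le)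
    qed
    ultimately show ?thesis using i by blast
  qed
  have "h \<noteq> - h"
    using assms(3) by (metis add.right_inverse scaleR_2 scaleR_eq_0_iff zero_neq_numeral)
  then have "(\<Sum>d\<in>{h, - h}. of_bool (points_into Q p d)) =
      (of_bool (points_into Q p h) + of_bool (points_into Q p (- h)) :: int)"
    by simp
  also have "\<dots> = of_bool (intermediate (perp h) Q p) + of_bool (p \<notin> Bd Q)"
    using intermediate one both interior by (auto simp: of_bool_def)
  finally show ?thesis .
qed

lemma points_into_total:
  assumes "finite Q" "\<not> collinear Q" "h \<noteq> 0" "inj_on (inner (perp h)) Q"
  shows "(\<Sum>p\<in>Q. \<Sum>d\<in>{h, - h}. of_bool (points_into Q p d)) =
           2 * int (card Q) - int (card (Bd Q)) - 2"
proof -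
  have "card Q \<ge> 2"
  proof (rule ccontr)
    assume "\<not> card Q \<ge> 2"
    then have "card Q = 0 \<or> card Q = 1" by auto
    then have "collinear Q" using assms(1) by (auto simp: card_1_singleton_iff)
    with assms(2) show False by blast
  qed
  have Bd: "Bd Q \<subseteq> Q" by (auto simp: Bd_def)
  have "(\<Sum>p\<in>Q. \<Sum>d\<in>{h, - h}. of_bool (points_into Q p d)) =
      (\<Sum>p\<in>Q. of_bool (intermediate (perp h) Q p) + of_bool (p \<notin> Bd Q) :: int)"
    using points_into_count[OF assms] by (intro sum.cong) auto
  also have "\<dots> = int (card {p \<in> Q. intermediate (perp h) Q p}) + int (card {p \<in> Q. p \<notin> Bd Q})"
    using assms(1) by (simp add: sum.distrib sum_of_bool_eq Int_def)
  also have "{p \<in> Q. p \<notin> Bd Q} = Q - Bd Q" by auto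
  also have "int (card (Q - Bd Q)) = int (card Q) - int (card (Bd Q))"
    using Bd assms(1) by (simp add: card_Diff_subset finite_subset card_mono of_nat_diff)
  also have "card {p \<in> Q. intermediate (perp h) Q p} = card Q - 2"
    by (rule card_intermediate[OF assms(1,4) \<open>card Q \<ge> 2\<close>])
  finally show ?thesis using \<open>card Q \<ge> 2\<close> by (simp add: of_nat_diff)
qed

text \<open>
  The tangent of the circle around \<open>c\<close> is a supporting line at each nearest site.
\<close>

lemma Bd_nearest:
  assumes "card (nearest P c) \<ge> 3"
  shows "Bd (nearest P c) = nearest P c"
proof -
  have "p \<in> Bd (nearest P c)" if p: "p \<in> nearest P c" for p
  proof -
    have "(p - c) \<bullet> (q - p) \<le> 0" if "q \<in> nearest P c" for q
    proof (cases "q = p")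
      case False
      have "dist c q \<le> dist c p" using nearest_equidistant[OF p that] by simp
      from inner_sphere_normal_neg[OF this False] show ?thesis by (rule less_imp_le)
    qed simp
    moreover have "p \<noteq> c"
    proof
      assume "p = c"
      have "q = c" if "q \<in> nearest P c" for q
        using nearest_equidistant[OF p that] \<open>p = c\<close> by simp
      then have "nearest P c \<subseteq> {c}" by blast
      then have "card (nearest P c) \<le> card {c}" by (intro card_mono) auto
      with assms show False by simp
    qed
    then have "p - c \<noteq> 0" by simp
    ultimately show ?thesis unfolding Bd_iff_supporting_line[OF p] by blast
  qed
  then show ?thesis by (auto simp: Bd_def)
qed

section \<open>Each ray enters exactly one Delaunay cell\<close>

text \<open>
  The pivot step. Some positive combination of \<open>q - p\<close> and \<open>x - p\<close> is a multiple of \<open>h\<close>; it has to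
  be a positive multiple because this combination and \<open>h\<close> both point strictly to the inner side of
  the tangent at \<open>p\<close> of the circle around \<open>c\<close>.
\<close>

lemma closer_point_gives_combination:
  assumes "h \<noteq> 0" "dist c q < dist c p" "dist c x \<le> dist c p" "(p - c) \<bullet> h < 0"
    and "(perp h \<bullet> (q - p)) * (perp h \<bullet> (x - p)) < 0"
  shows "\<exists>\<alpha>>0. \<exists>\<beta>>0. h = \<alpha> *\<^sub>R (q - p) + \<beta> *\<^sub>R (x - p)"
proof -
  obtain \<alpha> \<beta> t where c: "\<alpha> > 0" "\<beta> > 0" "\<alpha> *\<^sub>R (q - p) + \<beta> *\<^sub>R (x - p) = t *\<^sub>R h"
    using opposite_sides_combination[OF assms(1,5)] by blast
  have "q \<noteq> p" "x \<noteq> p" using assms(5) by auto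
  then have "(p - c) \<bullet> (q - p) < 0" "(p - c) \<bullet> (x - p) < 0"
    using assms(2,3) by (auto intro: inner_sphere_normal_neg)
  then have "(p - c) \<bullet> (\<alpha> *\<^sub>R (q - p) + \<beta> *\<^sub>R (x - p)) < 0"
    unfolding inner_add_right inner_scaleR_right
    using c(1,2) by (intro add_neg_neg mult_pos_neg) auto
  then have "t > 0" using assms(4) by (simp add: c(3) mult_less_0_iff)
  from positive_combination_rescale[OF c(1,2) this c(3)] show ?thesis .
qed

text \<open>
  Each pair \<open>(a, b)\<close> of points of \<open>P\<close> that represents \<open>h\<close> is a dual feasible basis of the program
  \<open>max h \<bullet> x\<close> over the Voronoi polygon of \<open>p\<close>; its basic solution is the circumcentre of \<open>p\<close>,
  \<open>a\<close>, \<open>b\<close>. Take the pair whose circumcentre \<open>c\<close> has the smallest value \<open>h \<bullet> c\<close>. A point \<open>q\<close>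
  inside the circle would violate a constraint, and exchanging it for whichever of \<open>a\<close>, \<open>b\<close> lies
  on the same side of \<open>p\<close> would lower the value.
\<close>

lemma exists_nearest_points_into:
  assumes "finite P" "h \<noteq> 0" "inj_on (inner (perp h)) P" "p \<in> P" "points_into P p h"
  shows "\<exists>c. p \<in> nearest P c \<and> points_into (nearest P c) p h"
proof -
  let ?comb = "\<lambda>a b. \<exists>\<alpha>>0. \<exists>\<beta>>0. h = \<alpha> *\<^sub>R (a - p) + \<beta> *\<^sub>R (b - p)"
  define M where "M = {(a, b) \<in> P \<times> P. ?comb a b}"
  let ?centre = "\<lambda>c (a, b). dist c a = dist c p \<and> dist c b = dist c p"
  have "\<exists>c. ?centre c ab" if abM: "ab \<in> M" for ab
  proof -
    obtain a b \<alpha> \<beta> where ab: "ab = (a, b)" "a \<in> P" "b \<in> P" "\<alpha> > 0" "\<beta> > 0"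
      "h = \<alpha> *\<^sub>R (a - p) + \<beta> *\<^sub>R (b - p)"
      using abM unfolding M_def by blast
    have "perp (a - p) \<bullet> (b - p) \<noteq> 0"
      by (rule combination_independent[OF assms(2-4) ab(2-6)])
    from linear_system_real2[OF this, of "(a \<bullet> a - p \<bullet> p) / 2" "(b \<bullet> b - p \<bullet> p) / 2"]
    obtain c where "(a - p) \<bullet> c = (a \<bullet> a - p \<bullet> p) / 2" "(b - p) \<bullet> c = (b \<bullet> b - p \<bullet> p) / 2"
      by blast
    then have "?centre c ab" by (simp add: ab(1) dist_eq_iff_inner)
    then show ?thesis ..
  qed
  then obtain ctr where ctr: "\<And>ab. ab \<in> M \<Longrightarrow> ?centre (ctr ab) ab" by metis
  have "finite M"
    by (rule finite_subset[of _ "P \<times> P"]) (use assms(1) in \<open>auto simp: M_def\<close>)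
  moreover have "M \<noteq> {}" using assms(5) by (auto simp: M_def points_into_def)
  ultimately obtain ab where ab_min: "ab \<in> M" "\<And>ab'. ab' \<in> M \<Longrightarrow> h \<bullet> ctr ab \<le> h \<bullet> ctr ab'"
    using finite_has_maximizer[of M "\<lambda>ab. - (h \<bullet> ctr ab)"] by auto
  obtain a b where ab: "ab = (a, b)" "a \<in> P" "b \<in> P" "?comb a b"
    using ab_min(1) by (auto simp: M_def)
  define c where "c = ctr ab"
  have cab: "dist c a = dist c p" "dist c b = dist c p"
    using ctr[OF ab_min(1)] by (simp_all add: c_def ab(1))
  obtain \<alpha> \<beta> where h: "\<alpha> > 0" "\<beta> > 0" "h = \<alpha> *\<^sub>R (a - p) + \<beta> *\<^sub>R (b - p)"
    using ab(4) by blast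
  have opp: "(perp h \<bullet> (a - p)) * (perp h \<bullet> (b - p)) < 0"
    by (rule combination_opposite_sides[OF assms(2-4) ab(2,3) h])
  have "(p - c) \<bullet> (a - p) < 0" "(p - c) \<bullet> (b - p) < 0"
    using opp cab by (auto intro!: inner_sphere_normal_neg)
  then have neg: "(p - c) \<bullet> h < 0"
    unfolding h(3) inner_add_right inner_scaleR_right
    using h(1,2) by (intro add_neg_neg mult_pos_neg) auto
  have empty: "dist c p \<le> dist c q" if q: "q \<in> P" for q
  proof (rule ccontr)
    assume "\<not> dist c p \<le> dist c q"
    then have closer: "dist c q < dist c p" by simp
    have "perp h \<bullet> (q - p) \<noteq> 0"
    proof
      assume "perp h \<bullet> (q - p) = 0"
      then have "q = p" using inj_onD[OF assms(3) _ q assms(4)] by (simp add: inner_diff_right)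
      with closer show False by simp
    qed
    \<comment> \<open>\<open>x\<close> is the one of \<open>a\<close>, \<open>b\<close> on the other side of \<open>p\<close> than \<open>q\<close>; it stays in the basis.\<close>
    then obtain x where x: "x \<in> P" "dist c x = dist c p"
      "(perp h \<bullet> (q - p)) * (perp h \<bullet> (x - p)) < 0"
      using opp ab(2,3) cab by (auto simp: mult_less_0_iff linorder_neq_iff)
    have comb: "?comb q x"
      using closer_point_gives_combination[OF assms(2) closer _ neg x(3)] x(2) by simp
    then have M: "(q, x) \<in> M" using q x(1) by (simp add: M_def)
    define c' where "c' = ctr (q, x)"
    have c': "dist c' q = dist c' p" "dist c' x = dist c' p"
      using ctr[OF M] by (simp_all add: c'_def)
    obtain \<gamma> \<delta> where g: "\<gamma> > 0" "\<delta> > 0" "h = \<gamma> *\<^sub>R (q - p) + \<delta> *\<^sub>R (x - p)"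
      using comb by blast
    \<comment> \<open>\<open>c'\<close> satisfies the constraint of \<open>q\<close> that \<open>c\<close> violates, and the constraint of \<open>x\<close> is tight at both.\<close>
    have "(q - p) \<bullet> c' < (q - p) \<bullet> c"
      using closer c'(1) unfolding dist_eq_iff_inner not_le[symmetric] dist_le_iff_inner
      by (simp add: algebra_simps)
    moreover have "(x - p) \<bullet> c' = (x - p) \<bullet> c"
      using x(2) c'(2) unfolding dist_eq_iff_inner by simp
    ultimately have "h \<bullet> c' < h \<bullet> c"
      using g(1) unfolding g(3) by (simp add: inner_add_left)
    moreover have "h \<bullet> c \<le> h \<bullet> c'" using ab_min(2)[OF M] by (simp add: c_def c'_def)
    ultimately show False by simp
  qed
  have "p \<in> nearest P c" "a \<in> nearest P c" "b \<in> nearest P c"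
    using empty cab ab(2,3) assms(4) by (auto simp: nearest_def)
  moreover then have "points_into (nearest P c) p h"
    using ab(4) by (auto simp: points_into_def)
  ultimately show ?thesis by blast
qed

lemma inner_le_if_nearest:
  assumes "p \<in> nearest P c" "q \<in> nearest P c" "p \<in> nearest P d"
  shows "(q - p) \<bullet> d \<le> (q - p) \<bullet> c"
proof -
  have "dist d p \<le> dist d q" using assms(2,3) by (simp add: nearest_def)
  moreover have "dist c q = dist c p" by (rule nearest_equidistant[OF assms(2,1)])
  ultimately show ?thesis unfolding dist_eq_iff_inner dist_le_iff_inner by simp
qed

text \<open>
  Weak duality: \<open>c\<close> maximises \<open>h\<close> over the Voronoi polygon of \<open>p\<close>.
\<close>

lemma points_into_nearest_maximal:
  assumes "p \<in> nearest P c" "points_into (nearest P c) p h" "p \<in> nearest P d"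
  shows "h \<bullet> d \<le> h \<bullet> c"
proof -
  obtain a b \<alpha> \<beta> where ab: "a \<in> nearest P c" "b \<in> nearest P c" "\<alpha> > 0" "\<beta> > 0"
    "h = \<alpha> *\<^sub>R (a - p) + \<beta> *\<^sub>R (b - p)"
    using assms(2) by (auto simp: points_into_def)
  have "\<alpha> * ((a - p) \<bullet> d) + \<beta> * ((b - p) \<bullet> d) \<le> \<alpha> * ((a - p) \<bullet> c) + \<beta> * ((b - p) \<bullet> c)"
    using inner_le_if_nearest[OF assms(1) ab(1) assms(3)]
      inner_le_if_nearest[OF assms(1) ab(2) assms(3)] ab(3,4)
    by (simp add: add_mono)
  then show ?thesis unfolding ab(5) by (simp add: inner_add_left)
qed

text \<open>
  Two maximisers give \<open>h\<close> the same value, so both satisfy with equality the constraints of \<open>a\<close> and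
  \<open>b\<close>, which occur in \<open>h\<close> with positive weight and are independent.
\<close>

lemma points_into_nearest_unique:
  assumes "h \<noteq> 0" "inj_on (inner (perp h)) P"
    and c: "p \<in> nearest P c" "points_into (nearest P c) p h"
    and d: "p \<in> nearest P d" "points_into (nearest P d) p h"
  shows "c = d"
proof -
  have eq: "h \<bullet> c = h \<bullet> d"
    using points_into_nearest_maximal[OF c d(1)] points_into_nearest_maximal[OF d c(1)] by simp
  obtain a b \<alpha> \<beta> where ab: "a \<in> nearest P c" "b \<in> nearest P c" "\<alpha> > 0" "\<beta> > 0"
    "h = \<alpha> *\<^sub>R (a - p) + \<beta> *\<^sub>R (b - p)"
    using c(2) by (auto simp: points_into_def)
  have inP: "p \<in> P" "a \<in> P" "b \<in> P" using c(1) ab(1,2) by (simp_all add: nearest_def)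
  have indep: "perp (a - p) \<bullet> (b - p) \<noteq> 0"
    by (rule combination_independent[OF assms(1,2) inP ab(3-5)])
  have sum: "\<alpha> * ((a - p) \<bullet> c) + \<beta> * ((b - p) \<bullet> c) = \<alpha> * ((a - p) \<bullet> d) + \<beta> * ((b - p) \<bullet> d)"
    using eq by (subst (asm) (1 2) ab(5)) (simp add: inner_add_left)
  have "\<alpha> * ((a - p) \<bullet> d) \<le> \<alpha> * ((a - p) \<bullet> c)" "\<beta> * ((b - p) \<bullet> d) \<le> \<beta> * ((b - p) \<bullet> c)"
    using inner_le_if_nearest[OF c(1) ab(1) d(1)] inner_le_if_nearest[OF c(1) ab(2) d(1)] ab(3,4)
    by simp_all
  with sum have "\<alpha> * ((a - p) \<bullet> c) = \<alpha> * ((a - p) \<bullet> d)" "\<beta> * ((b - p) \<bullet> c) = \<beta> * ((b - p) \<bullet> d)"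
    by linarith+
  then have "(a - p) \<bullet> c = (a - p) \<bullet> d" "(b - p) \<bullet> c = (b - p) \<bullet> d"
    using ab(3,4) by simp_all
  then show ?thesis by (rule linear_system_real2_unique[OF indep])
qed

lemma points_into_nearest_count:
  assumes "finite P" "h \<noteq> 0" "inj_on (inner (perp h)) P" "p \<in> P"
  shows "(\<Sum>c\<in>{c. card (nearest P c) \<ge> 3}. of_bool (p \<in> nearest P c \<and> points_into (nearest P c) p h))
           = (of_bool (points_into P p h) :: int)"
proof -
  let ?V = "{c. card (nearest P c) \<ge> 3}"
  let ?R = "\<lambda>c. p \<in> nearest P c \<and> points_into (nearest P c) p h"
  have fin: "finite ?V" by (rule finite_voronoi_vertices[OF assms(1)])
  have V: "c \<in> ?V" if "?R c" for c
  proof -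
    have "inj_on (inner (perp h)) (nearest P c)" "finite (nearest P c)"
      using assms(1,3) nearest_subset by (auto intro: inj_on_subset finite_subset)
    then show ?thesis using points_into_imp_card_ge_3[OF assms(2)] that by blast
  qed
  show ?thesis
  proof (cases "points_into P p h")
    case True
    then obtain c where c: "?R c" using exists_nearest_points_into[OF assms] by blast
    have "?R d \<longleftrightarrow> d = c" for d
      using c points_into_nearest_unique[OF assms(2,3)] by blast
    then have "(\<Sum>d\<in>?V. of_bool (?R d)) = (\<Sum>d\<in>?V. of_bool (d = c) :: int)" by simp
    also have "\<dots> = 1" using V[OF c] fin by (simp add: of_bool_def)
    finally show ?thesis using True by simp
  next
    case False
    then have "\<not> points_into (nearest P c) p h" for c
      using nearest_subset unfolding points_into_def by blast
    then show ?thesis using False by simp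
  qed
qed

section \<open>The counting formula\<close>

theorem theorem1:
  fixes P :: "(real^2) set"
  assumes "finite P" and "\<not> collinear P"
  shows "int (card (voronoi_iteration P)) =
           2 * int (card P) - int (card (Bd P)) - cocircularity P - 2"
proof -
  let ?V = "{c. card (nearest P c) \<ge> 3}"
  let ?N = "nearest P"
  obtain h where h: "h \<noteq> 0" "inj_on (inner (perp h)) P"
    using exists_generic_direction[OF assms(1)] by blast
  have inj': "inj_on (inner (perp d)) P" "d \<noteq> 0" if "d \<in> {h, - h}" for d
    using that h by (auto simp: perp_minus inj_on_inner_uminus)
  have N: "finite (?N c)" "inj_on (inner (perp h)) (?N c)" for c
    using assms(1) h(2) nearest_subset by (auto intro: inj_on_subset finite_subset)
  have "int (card ?V) + cocircularity P = (\<Sum>c\<in>?V. int (card (?N c)) - 2)"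
    by (simp add: cocircularity_eq[OF assms(1)] sum_subtractf)
  \<comment> \<open>Count the rays into the hull of each set of nearest sites, and then regroup them by their origin.\<close>
  also have "\<dots> = (\<Sum>c\<in>?V. \<Sum>p\<in>?N c. \<Sum>d\<in>{h, - h}. of_bool (points_into (?N c) p d))"
  proof (rule sum.cong[OF refl])
    fix c assume "c \<in> ?V"
    then have "card (?N c) \<ge> 3" by simp
    then show "int (card (?N c)) - 2 =
        (\<Sum>p\<in>?N c. \<Sum>d\<in>{h, - h}. of_bool (points_into (?N c) p d))"
      using points_into_total[OF N(1) not_collinear_nearest h(1) N(2)] by (simp add: Bd_nearest)
  qed
  also have "\<dots> = (\<Sum>c\<in>?V. \<Sum>p\<in>P. \<Sum>d\<in>{h, - h}. of_bool (p \<in> ?N c \<and> points_into (?N c) p d))"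
    using assms(1) by (intro sum.cong refl sum.mono_neutral_cong_left) (auto simp: nearest_def)
  also have "\<dots> = (\<Sum>p\<in>P. \<Sum>c\<in>?V. \<Sum>d\<in>{h, - h}. of_bool (p \<in> ?N c \<and> points_into (?N c) p d))"
    by (rule sum.swap)
  also have "\<dots> = (\<Sum>p\<in>P. \<Sum>d\<in>{h, - h}. \<Sum>c\<in>?V. of_bool (p \<in> ?N c \<and> points_into (?N c) p d))"
    by (rule sum.cong[OF refl]) (rule sum.swap)
  also have "\<dots> = (\<Sum>p\<in>P. \<Sum>d\<in>{h, - h}. of_bool (points_into P p d))"
    using inj' by (intro sum.cong refl points_into_nearest_count[OF assms(1)])
  also have "\<dots> = 2 * int (card P) - int (card (Bd P)) - 2"
    by (rule points_into_total[OF assms h])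
  finally show ?thesis by (simp add: voronoi_iteration_eq[OF assms(1)])
qed

end
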